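(* Let $G$ be a simple graph on $[0,n]$ and $F\subseteq E(G\setminus 0)$. Let $$\mathbf{b}_G^F=\left(\mathrm{indeg}_G(1)-\mathrm{outdeg}_F(1),\ldots,\mathrm{indeg}_G(n)-\mathrm{outdeg}_F(n),\,-\#E(G\setminus F)\right)$$ and let $\psi$ be the map that takes a flow on $\widetilde{G}\setminus\{s,0\}$ to the tuple of its values on the edges $\{(j,t)\mid j\in[n]\}$. Then $\mathrm{LD}(G,F)$ equals the (multiset) image under $\psi$ of all integral flows on $\widetilde{G}\setminus\{s,0\}$ with netflow vector $\mathbf{b}_G^F$. In particular, $\mathrm{LD}(G,F)$ is in bijection with integral flows on $\widetilde{G}\setminus\{s,0\}$ with netflow $\mathbf{b}_G^F$.
   Context: Notation: $[m,n]=\{m,\dots,n\}$, $[n]=[1,n]$. Graphs on $[0,n]$ are finite directed graphs with edges directed from smaller to larger endpoint; $(i,j)$ with $i<j$ is an edge from $i$ to $j$. Simple means no multiple edges. $G\setminus 0$ is $G$ with vertex $0$ and its incident edges deleted; $G\setminus F$ is $G$ with the edges in $F$ deleted; $G[0,i]$ is the restriction of $G$ to $[0,i]$. $\mathrm{indeg}_G(i)$ is the number of edges of $G$ incoming to $i$; viewing $F$ as a subgraph, $\mathrm{outdeg}_F(j)=\#\{(j,k)\in F\}$. $\widetilde{G}$ is the graph on $[0,n]\cup\{s,t\}$, ordered $s<0<1<\cdots<n<t$, with edges $E(G)\cup\{(s,i),(i,t)\mid i\in[0,n]\}$. Thus $\widetilde G\setminus\{s,0\}$ has vertices $[n]\cup\{t\}$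 and edges $E(G\setminus0)\cup\{(i,t)\mid i\in[n]\}$. A flow on a graph with netflow vector $(a_v)_v$ is an assignment of nonnegative real numbers $f(e)$ to the edges such that for every vertex $v$, the sum of $f$ over edges leaving $v$ minus the sum of $f$ over edges entering $v$ equals $a_v$; it is integral if all $f(e)$ are integers. Netflow vectors are listed in the vertex order $1,\dots,n,t$. For $F\subseteq E(G\setminus 0)$ put $f_{ij}=\#\{(j,k)\in F\mid k\le i\}$. $\mathrm{Tri}_G(F)$ is the following system of constraints in variables $a_{ij}$, $1\le j\le i\le n$: (i) $f_{nj}\le a_{nj}+f_{nj}$ for $j\in[n]$; (ii) for $n\ge i>j\ge1$: $a_{ij}+f_{ij}\le a_{i-1,j}+f_{i-1,j}$ if $(j,i)\in E(G)$, and $a_{ij}+f_{ij}=a_{i-1,j}+f_{i-1,j}$ if $(j,i)\notin E(G)$; (iii) $a_{ii}=\#E(G[0,i])-\sum_{k=1}^{i-1}(a_{ik}+f_{ik})$ for $i\in[n]$. $\mathrm{Sol}_G(F)$ is the collection of all integer solutions (arrays $(a_{ij})$) of $\mathrm{Tri}_G(F)$, and $\mathrm{LD}(G,F)$ is the multiset of first columns $(a_{n1},\dots,a_{nn})$ of the arrays in $\mathrm{Sol}_G(F)$, one for each array. *)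

theory Defs
  imports
    Complex_Main
    "HOL-Library.FuncSet"
    "HOL-Library.Multiset"
    "Graph_Theory.Pair_Digraph"
    "Graph_Theory.Digraph_Component"
begin

text \<open>
  A simple graph has no parallel edges, so its edges are pairs; every edge points from its
  smaller to its larger endpoint, and finiteness follows.
\<close>

definition simple_graph_on :: "nat \<Rightarrow> nat pair_pre_digraph \<Rightarrow> bool" where
  "simple_graph_on n G \<longleftrightarrow>
     pair_wf_digraph G \<and> pverts G = {0..n} \<and> (\<forall>(i, j) \<in> parcs G. i < j)"

definition del_verts :: "('v, 'e) pre_digraph \<Rightarrow> 'v set \<Rightarrow> ('v, 'e) pre_digraph" where
  "del_verts H X = H \<restriction> (verts H - X)"

datatype ext_vertex = Source | Vtx nat | Sink

definition tilde :: "nat pair_pre_digraph \<Rightarrow> ext_vertex pair_pre_digraph" where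
  "tilde G =
     \<lparr> pverts = Vtx ` pverts G \<union> {Source, Sink},
       parcs = map_prod Vtx Vtx ` parcs G
         \<union> {(Source, Vtx i) | i. i \<in> pverts G} \<union> {(Vtx i, Sink) | i. i \<in> pverts G} \<rparr>"

definition flow_graph :: "nat pair_pre_digraph \<Rightarrow> (ext_vertex, ext_vertex \<times> ext_vertex) pre_digraph" where
  "flow_graph G = del_verts (with_proj (tilde G)) {Source, Vtx 0}"

text \<open>
  Flows and solution arrays live on a finite index set.  They are functions that are
  \<^const>\<open>undefined\<close> outside of it (the function space \<^const>\<open>PiE\<close>), so that equality of
  functions is equality on the index set and counting them is meaningful.
\<close>

definition flows :: "('v, 'e) pre_digraph \<Rightarrow> ('v \<Rightarrow> real) \<Rightarrow> ('e \<Rightarrow> real) set" where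
  "flows H b =
     {f \<in> arcs H \<rightarrow>\<^sub>E {0..}.
        \<forall>v \<in> verts H. (\<Sum>e \<in> out_arcs H v. f e) - (\<Sum>e \<in> in_arcs H v. f e) = b v}"

definition integral_flows :: "('v, 'e) pre_digraph \<Rightarrow> ('v \<Rightarrow> real) \<Rightarrow> ('e \<Rightarrow> real) set" where
  "integral_flows H b = {f \<in> flows H b. \<forall>e \<in> arcs H. f e \<in> \<int>}"

text \<open>
  The graph \<^term>\<open>G\<lparr>parcs := F\<rparr>\<close> is \<^term>\<open>F\<close> viewed as a subgraph of \<^term>\<open>G\<close>.  The netflow vector
  is only ever read at the vertices \<open>1, \<dots>, n\<close> and \<^const>\<open>Sink\<close> of \<^term>\<open>flow_graph G\<close>.
\<close>

fun netflow :: "nat pair_pre_digraph \<Rightarrow> (nat \<times> nat) set \<Rightarrow> ext_vertex \<Rightarrow> real" where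
  "netflow G F (Vtx i) =
     real (in_degree (with_proj G) i) - real (out_degree (with_proj (G\<lparr>parcs := F\<rparr>)) i)"
| "netflow G F Sink = - real (card (parcs G - F))"
| "netflow G F Source = 0"

definition psi :: "nat \<Rightarrow> (ext_vertex \<times> ext_vertex \<Rightarrow> real) \<Rightarrow> real list" where
  "psi n f = map (\<lambda>j. f (Vtx j, Sink)) [1..<n+1]"

definition fcount :: "(nat \<times> nat) set \<Rightarrow> nat \<Rightarrow> nat \<Rightarrow> nat" where
  "fcount F i j = card {e \<in> F. fst e = j \<and> snd e \<le> i}"

definition Tri :: "nat \<Rightarrow> nat pair_pre_digraph \<Rightarrow> (nat \<times> nat) set \<Rightarrow> (nat \<times> nat \<Rightarrow> real) \<Rightarrow> bool" where
  "Tri n G F a \<longleftrightarrow>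
     (\<forall>j \<in> {1..n}. real (fcount F n j) \<le> a (n, j) + real (fcount F n j)) \<and>
     (\<forall>i j. n \<ge> i \<and> i > j \<and> j \<ge> 1 \<longrightarrow>
        (if (j, i) \<in> parcs G
         then a (i, j) + real (fcount F i j) \<le> a (i - 1, j) + real (fcount F (i - 1) j)
         else a (i, j) + real (fcount F i j) = a (i - 1, j) + real (fcount F (i - 1) j))) \<and>
     (\<forall>i \<in> {1..n}. a (i, i) =
        real (card (arcs (with_proj G \<restriction> {0..i}))) - (\<Sum>k = 1..i - 1. (a (i, k) + real (fcount F i k))))"

definition Sol :: "nat \<Rightarrow> nat pair_pre_digraph \<Rightarrow> (nat \<times> nat) set \<Rightarrow> (nat \<times> nat \<Rightarrow> real) set" where
  "Sol n G F = {a \<in> {(i, j). 1 \<le> j \<and> j \<le> i \<and> i \<le> n} \<rightarrow>\<^sub>E \<int>. Tri n G F a}"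

text \<open>
  Since \<^const>\<open>mset_set\<close> sends infinite sets to the empty multiset, the following definition is
  meaningful only if \<^term>\<open>Sol n G F\<close> is finite, which has to be asserted alongside.
\<close>

definition LD :: "nat \<Rightarrow> nat pair_pre_digraph \<Rightarrow> (nat \<times> nat) set \<Rightarrow> real list multiset" where
  "LD n G F = image_mset (\<lambda>a. map (\<lambda>j. a (n, j)) [1..<n+1]) (mset_set (Sol n G F))"

text \<open>The elements of a multiset, with the copies of each element told apart by a counter.\<close>

definition copies :: "'a multiset \<Rightarrow> ('a \<times> nat) set" where
  "copies M = {(x, k). k < count M x}"

end

theory Submission
  imports Defs
begin

text \<open>
  Put \<open>b\<^sub>i\<^sub>j = a\<^sub>i\<^sub>j + f\<^sub>i\<^sub>j\<close>. Each column of \<open>b\<close> decreases weakly, with constant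
  steps off the edges of \<open>G\<close>, so the drops \<open>b\<^sub>i\<^sub>-\<^sub>1\<^sub>,\<^sub>j - b\<^sub>i\<^sub>j\<close> are the values of a flow on the edges
  \<open>(j, i)\<close>, and \<open>a\<^sub>n\<^sub>j\<close> is its value on \<open>(j, t)\<close>. Condition (iii) says that row \<open>i\<close> of \<open>b\<close> sums to
  \<open>#E(G[0,i])\<close>; the difference of two consecutive rows of this identity is flow conservation at
  the vertex \<open>i\<close>, and the last row is conservation at \<open>t\<close>. The row sums also bound the entries
  of \<open>b\<close>, which gives finiteness.
\<close>

section \<open>Multiplicities in an image multiset, and a telescoping sum\<close>

lemma count_image_mset_set:
  assumes "finite A"
  shows "count (image_mset g (mset_set A)) x = card {a \<in> A. g a = x}"
proof -
  have "count (image_mset g (mset_set A)) x = (\<Sum>a\<in>{a \<in> A. g a = x}. 1)"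
    unfolding count_image_mset using assms
    by (intro sum.cong) auto
  then show ?thesis by simp
qed

text \<open>The multiplicity of \<open>x\<close> is the size of the fibre of \<open>g\<close> over
  \<open>x\<close>, so an enumeration of each fibre matches it with the copies of \<open>x\<close>.
  The fibres partition \<open>A\<close>, hence the enumerations glue to one bijection.\<close>

lemma copies_image_mset_bij:
  assumes "finite A"
  shows "\<exists>\<phi>. bij_betw \<phi> (copies (image_mset g (mset_set A))) A \<and>
    (\<forall>(x, k) \<in> copies (image_mset g (mset_set A)). g (\<phi> (x, k)) = x)"
proof -
  have "\<exists>h. bij_betw h {0..<card {a \<in> A. g a = x}} {a \<in> A. g a = x}" for x
    using assms by (intro ex_bij_betw_nat_finite) auto
  then obtain h where h: "\<And>x. bij_betw (h x) {0..<card {a \<in> A. g a = x}} {a \<in> A. g a = x}"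
    by metis
  let ?C = "copies (image_mset g (mset_set A))"
  let ?\<phi> = "\<lambda>(x, k). h x k"
  have C: "?C = (SIGMA x:UNIV. {0..<card {a \<in> A. g a = x}})"
    by (auto simp: copies_def count_image_mset_set[OF assms])
  have mem: "h x k \<in> A \<and> g (h x k) = x" if "(x, k) \<in> ?C" for x k
    using that bij_betwE[OF h[of x]] unfolding C by auto
  have "inj_on ?\<phi> ?C"
  proof (rule inj_onI, clarify)
    fix x k y l assume a: "(x, k) \<in> ?C" "(y, l) \<in> ?C" "h x k = h y l"
    \<comment> \<open>Applying \<open>g\<close> recovers the index of the fibre, so different fibres
      cannot collide.\<close>
    then have "x = y" using mem by metis
    with a h[of x] show "x = y \<and> k = l"
      unfolding C by (auto simp: bij_betw_def dest: inj_onD)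
  qed
  moreover have "A \<subseteq> ?\<phi> ` ?C"
  proof
    fix a assume "a \<in> A"
    then have "a \<in> h (g a) ` {0..<card {a' \<in> A. g a' = g a}}"
      using h[of "g a"] by (auto simp: bij_betw_def)
    then show "a \<in> ?\<phi> ` ?C" unfolding C by force
  qed
  ultimately have "bij_betw ?\<phi> ?C A"
    using mem by (auto simp: bij_betw_def)
  then show ?thesis using mem by (intro exI[of _ ?\<phi>]) auto
qed

lemma sum_drop_telescope:
  fixes f :: "nat \<Rightarrow> 'a::ab_group_add"
  assumes "m \<le> n"
  shows "(\<Sum>k\<in>{Suc m..n}. f (k - 1) - f k) = f m - f n"
  using sum_telescope''[OF assms, of "\<lambda>k. - f k"] by simp

section \<open>The entries b, edge values, and the two maps\<close>

definition shifted :: "(nat \<times> nat) set \<Rightarrow> (nat \<times> nat \<Rightarrow> real) \<Rightarrow> nat \<Rightarrow> nat \<Rightarrow> real" where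
  "shifted F a i j = a (i, j) + real (fcount F i j)"

text \<open>Extending a flow by 0 to non-edges lets sums run over intervals of vertices, and turns
  the equality case of (ii) into a drop of 0. Tails start at 1 in all uses, since edges out of 0 are
  no arcs of the flow graph.\<close>

definition edge_value :: "nat pair_pre_digraph \<Rightarrow> (ext_vertex \<times> ext_vertex \<Rightarrow> real) \<Rightarrow> nat \<Rightarrow> nat \<Rightarrow> real" where
  "edge_value G f j i = (if (j, i) \<in> parcs G then f (Vtx j, Vtx i) else 0)"

text \<open>The edge set of G[0,i]: edges go up, so bounding the head also bounds the tail.\<close>

definition prefix_edges :: "nat pair_pre_digraph \<Rightarrow> nat \<Rightarrow> (nat \<times> nat) set" where
  "prefix_edges G i = {e \<in> parcs G. snd e \<le> i}"

definition flow_of_array ::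
  "nat \<Rightarrow> nat pair_pre_digraph \<Rightarrow> (nat \<times> nat) set \<Rightarrow> (nat \<times> nat \<Rightarrow> real) \<Rightarrow> ext_vertex \<times> ext_vertex \<Rightarrow> real" where
  "flow_of_array n G F a = restrict
     (\<lambda>e. case e of (Vtx j, Vtx i) \<Rightarrow> shifted F a (i - 1) j - shifted F a i j
                  | (Vtx j, Sink) \<Rightarrow> a (n, j) | _ \<Rightarrow> 0)
     (arcs (flow_graph G))"

text \<open>Column \<open>j\<close> of b is rebuilt from its last entry, the value on the edge to t
  plus \<open>fcount F n j\<close>, by adding back the drops below row \<open>i\<close>. Subtracting
  \<open>fcount F i j\<close> then returns from b to a.\<close>

definition array_of_flow ::
  "nat \<Rightarrow> nat pair_pre_digraph \<Rightarrow> (nat \<times> nat) set \<Rightarrow> (ext_vertex \<times> ext_vertex \<Rightarrow> real) \<Rightarrow> nat \<times> nat \<Rightarrow> real" where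
  "array_of_flow n G F f = restrict
     (\<lambda>(i, j). f (Vtx j, Sink) + real (fcount F n j) - real (fcount F i j)
               + (\<Sum>k\<in>{Suc i..n}. edge_value G f j k))
     {(i, j). 1 \<le> j \<and> j \<le> i \<and> i \<le> n}"

section \<open>Arcs of the flow graph and sums at its vertices\<close>

context
  fixes n :: nat and G :: "nat pair_pre_digraph" and F :: "(nat \<times> nat) set"
  assumes G: "simple_graph_on n G"
    and F: "F \<subseteq> arcs (del_verts (with_proj G) {0})"
begin

lemma parcsD:
  assumes "(j, i) \<in> parcs G"
  shows "j < i" "i \<le> n"
  using G assms by (auto simp: simple_graph_on_def pair_wf_digraph_def)

lemma verts_G: "pverts G = {0..n}"
  using G by (simp add: simple_graph_on_def)

lemma finite_parcs: "finite (parcs G)"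
  using parcsD by (intro finite_subset[of "parcs G" "{0..n} \<times> {0..n}"]) fastforce+

lemma F_subset: "F \<subseteq> {e \<in> parcs G. 1 \<le> fst e}"
  using F by (auto simp: del_verts_def induce_subgraph_def)

lemma finite_F: "finite F"
  using F_subset finite_parcs by (auto intro: finite_subset)

lemma arcs_flow_graph:
  "arcs (flow_graph G) = {(Vtx j, Vtx i) | j i. (j, i) \<in> parcs G \<and> 1 \<le> j}
     \<union> {(Vtx j, Sink) | j. j \<in> {1..n}}"
proof -
  have "j \<in> {0..n} \<and> i \<in> {1..n}" if "(j, i) \<in> parcs G" for j i
    using parcsD[OF that] by auto
  \<comment> \<open>No edge enters 0, so deleting 0 only removes edges of \<open>G\<close> with tail
    0; hence the condition on the tail alone.\<close>
  moreover have "(j, 0) \<notin> parcs G" for j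
    using parcsD by blast
  ultimately show ?thesis
    by (auto simp: verts_G flow_graph_def del_verts_def induce_subgraph_def tilde_def)
qed

lemma verts_flow_graph: "verts (flow_graph G) = Vtx ` {1..n} \<union> {Sink}"
  using verts_G
  by (auto simp: flow_graph_def del_verts_def induce_subgraph_def tilde_def)

lemma tail_head_flow_graph: "tail (flow_graph G) = fst" "head (flow_graph G) = snd"
  by (auto simp: flow_graph_def del_verts_def induce_subgraph_def)

lemma sum_out_arcs:
  assumes "j \<in> {1..n}"
  shows "(\<Sum>e\<in>out_arcs (flow_graph G) (Vtx j). f e)
    = (\<Sum>i\<in>{Suc j..n}. edge_value G f j i) + f (Vtx j, Sink)"
proof -
  let ?I = "{i \<in> {Suc j..n}. (j, i) \<in> parcs G}"
  have *: "out_arcs (flow_graph G) (Vtx j) = insert (Vtx j, Sink) ((\<lambda>i. (Vtx j, Vtx i)) ` ?I)"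
    using assms parcsD by (fastforce simp: out_arcs_def arcs_flow_graph tail_head_flow_graph)
  have "(\<Sum>e\<in>out_arcs (flow_graph G) (Vtx j). f e)
      = f (Vtx j, Sink) + (\<Sum>e\<in>(\<lambda>i. (Vtx j, Vtx i)) ` ?I. f e)"
    unfolding * by (subst sum.insert) auto
  also have "(\<Sum>e\<in>(\<lambda>i. (Vtx j, Vtx i)) ` ?I. f e) = (\<Sum>i\<in>?I. f (Vtx j, Vtx i))"
    by (subst sum.reindex) (auto simp: inj_on_def)
  also have "\<dots> = (\<Sum>i\<in>{Suc j..n}. edge_value G f j i)"
    unfolding edge_value_def by (rule sum.inter_filter) simp
  finally show ?thesis by simp
qed

lemma sum_in_arcs:
  assumes "i \<in> {1..n}"
  shows "(\<Sum>e\<in>in_arcs (flow_graph G) (Vtx i). f e) = (\<Sum>j\<in>{1..<i}. edge_value G f j i)"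
proof -
  let ?I = "{j \<in> {1..<i}. (j, i) \<in> parcs G}"
  have *: "in_arcs (flow_graph G) (Vtx i) = (\<lambda>j. (Vtx j, Vtx i)) ` ?I"
    using assms parcsD by (fastforce simp: in_arcs_def arcs_flow_graph tail_head_flow_graph)
  have "(\<Sum>e\<in>in_arcs (flow_graph G) (Vtx i). f e) = (\<Sum>j\<in>?I. f (Vtx j, Vtx i))"
    unfolding * by (subst sum.reindex) (auto simp: inj_on_def)
  also have "\<dots> = (\<Sum>j\<in>{1..<i}. edge_value G f j i)"
    unfolding edge_value_def by (rule sum.inter_filter) simp
  finally show ?thesis .
qed

lemma sum_in_arcs_Sink:
  "(\<Sum>e\<in>in_arcs (flow_graph G) Sink. f e) = (\<Sum>j\<in>{1..n}. f (Vtx j, Sink))"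
proof -
  have *: "in_arcs (flow_graph G) Sink = (\<lambda>j. (Vtx j, Sink)) ` {1..n}"
    by (auto simp: in_arcs_def arcs_flow_graph tail_head_flow_graph)
  show ?thesis unfolding * by (subst sum.reindex) (auto simp: inj_on_def)
qed

lemma out_arcs_Sink: "out_arcs (flow_graph G) Sink = {}"
  by (auto simp: out_arcs_def arcs_flow_graph tail_head_flow_graph)

section \<open>Counting edges of \<open>G\<close> and \<open>F\<close>\<close>

lemma card_prefix_edges_step:
  assumes "1 \<le> i"
  shows "card (prefix_edges G i) = card (prefix_edges G (i - 1)) + in_degree (with_proj G) i"
proof -
  \<comment> \<open>The edges gained in passing from G[0,i-1] to G[0,i] are those with head
    \<open>i\<close>, including one from 0 if present. This is why the netflow has the indegree in
    \<open>G\<close> and not in G without 0.\<close>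
  have "prefix_edges G i = prefix_edges G (i - 1) \<union> in_arcs (with_proj G) i"
    using assms by (auto simp: prefix_edges_def in_arcs_def)
  moreover have "prefix_edges G (i - 1) \<inter> in_arcs (with_proj G) i = {}"
    using assms by (auto simp: prefix_edges_def in_arcs_def)
  ultimately show ?thesis unfolding in_degree_def
    using finite_parcs by (subst card_Un_disjoint[symmetric]) (auto simp: prefix_edges_def in_arcs_def)
qed

lemma prefix_edges_0: "prefix_edges G 0 = {}"
  using parcsD by (fastforce simp: prefix_edges_def)

lemma prefix_edges_n: "prefix_edges G n = parcs G"
  using parcsD by (auto simp: prefix_edges_def)

lemma arcs_restrict: "arcs (with_proj G \<restriction> {0..i}) = prefix_edges G i"
  using parcsD by (force simp: induce_subgraph_def prefix_edges_def)

text \<open>Edges of \<open>F\<close> leaving \<open>j\<close> have a head beyond \<open>j\<close>.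
  Thus a and b agree on the diagonal, and (iii) becomes a statement about b alone.\<close>

lemma fcount_diag: "fcount F j j = 0"
proof -
  have "{e \<in> F. fst e = j \<and> snd e \<le> j} = {}"
    using F_subset parcsD by fastforce
  then show ?thesis unfolding fcount_def by (simp only: card.empty)
qed

lemma out_degree_F: "out_degree (with_proj (G\<lparr>parcs := F\<rparr>)) j = fcount F n j"
  using F_subset parcsD unfolding out_degree_def fcount_def out_arcs_def
  by (intro arg_cong[of _ _ card]) fastforce

text \<open>As \<open>F\<close> avoids the vertex 0, each of its edges is counted at exactly one
  tail in [n].\<close>

lemma sum_fcount: "(\<Sum>j\<in>{1..n}. fcount F n j) = card F"
proof -
  have "card F = card (\<Union>j\<in>{1..n}. {e \<in> F. fst e = j \<and> snd e \<le> n})"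
    using F_subset parcsD by (intro arg_cong[of _ _ card]) fastforce
  also have "\<dots> = (\<Sum>j\<in>{1..n}. fcount F n j)"
    unfolding fcount_def using finite_F by (intro card_UN_disjoint) auto
  finally show ?thesis by simp
qed

lemma card_diff_F: "real (card (parcs G - F)) = real (card (parcs G)) - real (card F)"
  using F_subset finite_parcs finite_F
  by (subst card_Diff_subset) (auto intro!: of_nat_diff card_mono)

section \<open>Flows and arrays described by sums over intervals\<close>

lemma integral_flows_iff:
  "f \<in> integral_flows (flow_graph G) (netflow G F) \<longleftrightarrow>
     f \<in> arcs (flow_graph G) \<rightarrow>\<^sub>E {0..} \<inter> \<int> \<and>
     (\<forall>j\<in>{1..n}. (\<Sum>i\<in>{Suc j..n}. edge_value G f j i) + f (Vtx j, Sink)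
          - (\<Sum>k\<in>{1..<j}. edge_value G f k j)
        = real (in_degree (with_proj G) j) - real (fcount F n j)) \<and>
     (\<Sum>j\<in>{1..n}. f (Vtx j, Sink)) = real (card (parcs G)) - real (card F)"
proof -
  have "f \<in> integral_flows (flow_graph G) (netflow G F) \<longleftrightarrow>
     f \<in> arcs (flow_graph G) \<rightarrow>\<^sub>E {0..} \<inter> \<int> \<and>
     (\<forall>v \<in> verts (flow_graph G). (\<Sum>e \<in> out_arcs (flow_graph G) v. f e)
        - (\<Sum>e \<in> in_arcs (flow_graph G) v. f e) = netflow G F v)"
    by (auto simp: integral_flows_def flows_def PiE_iff)
  \<comment> \<open>Conservation at the sink has no outflow term, so both of its sides are negated.
    Disabling \<open>minus_diff_eq\<close> below keeps the right side in the shape that this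
    equivalence matches.\<close>
  moreover have "- x = - (y - z) \<longleftrightarrow> x = y - z" for x y z :: real
    by auto
  ultimately show ?thesis
    by (simp add: verts_flow_graph ball_Un sum_out_arcs sum_in_arcs sum_in_arcs_Sink out_arcs_Sink
        card_diff_F out_degree_F conj_ac del: minus_diff_eq)
qed

lemma row_sums_iff:
  "(\<forall>i\<in>{1..n}. a (i, i) = real (card (arcs (with_proj G \<restriction> {0..i})))
       - (\<Sum>k = 1..i - 1. (a (i, k) + real (fcount F i k))))
   \<longleftrightarrow> (\<forall>i\<in>{1..n}. (\<Sum>k\<in>{1..i}. shifted F a i k) = real (card (prefix_edges G i)))"
proof (rule ball_cong[OF refl])
  fix i assume i: "i \<in> {1..n}"
  have "(\<Sum>k\<in>{1..i}. shifted F a i k) = (\<Sum>k\<in>{1..i-1}. shifted F a i k) + a (i, i)"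
    using i by (cases i) (auto simp: shifted_def fcount_diag)
  then show "(a (i, i) = real (card (arcs (with_proj G \<restriction> {0..i})))
       - (\<Sum>k = 1..i - 1. (a (i, k) + real (fcount F i k)))) \<longleftrightarrow>
    ((\<Sum>k\<in>{1..i}. shifted F a i k) = real (card (prefix_edges G i)))"
    unfolding arcs_restrict by (auto simp: shifted_def)
qed

text \<open>Conservation at \<open>j\<close> is the identity for row \<open>j\<close> minus that for
  row \<open>j - 1\<close>. Stated for arbitrary \<open>x\<close> and \<open>b\<close> linked by
  drops, it serves both directions of the correspondence.\<close>

lemma row_sums_iff_conservation:
  assumes "\<And>i j. \<lbrakk>1 \<le> j; j < i; i \<le> n\<rbrakk> \<Longrightarrow> x j i = b (i - 1) j - b i j"
  shows "(\<forall>i\<in>{1..n}. (\<Sum>k\<in>{1..i}. b i k) = real (card (prefix_edges G i))) \<longleftrightarrow>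
    (\<forall>j\<in>{1..n}. (\<Sum>i\<in>{Suc j..n}. x j i) + b n j - (\<Sum>k\<in>{1..<j}. x k j)
       = real (in_degree (with_proj G) j))" (is "?L \<longleftrightarrow> ?R")
proof -
  have step: "(\<Sum>i\<in>{Suc j..n}. x j i) + b n j - (\<Sum>k\<in>{1..<j}. x k j)
      = (\<Sum>k\<in>{1..j}. b j k) - (\<Sum>k\<in>{1..j-1}. b (j - 1) k)" if "j \<in> {1..n}" for j
  proof -
    \<comment> \<open>The outflow telescopes down column \<open>j\<close>, and its last entry
      cancels against \<open>b n j\<close>. What is left is the entry \<open>b j j\<close>, by which
      row \<open>j\<close> is longer than row \<open>j - 1\<close>.\<close>
    have "(\<Sum>i\<in>{Suc j..n}. x j i) = (\<Sum>i\<in>{Suc j..n}. b (i - 1) j - b i j)"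
      using assms that by (intro sum.cong) auto
    also have "\<dots> = b j j - b n j"
      using that sum_drop_telescope[of j n "\<lambda>i. b i j"] by simp
    moreover have "(\<Sum>k\<in>{1..<j}. x k j) = (\<Sum>k\<in>{1..j-1}. b (j - 1) k - b j k)"
      using assms that by (intro sum.cong) auto
    moreover have "(\<Sum>k\<in>{1..j}. b j k) = (\<Sum>k\<in>{1..j-1}. b j k) + b j j"
      using that by (cases j) auto
    ultimately show ?thesis by (simp add: sum_subtractf)
  qed
  have deg: "real (card (prefix_edges G j)) = real (card (prefix_edges G (j - 1)))
      + real (in_degree (with_proj G) j)" if "j \<in> {1..n}" for j
    using card_prefix_edges_step[of j] that by simp
  show ?thesis
  proof
    assume L: ?L
    show ?R
    proof
      fix j assume j: "j \<in> {1..n}"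
      have "(\<Sum>k\<in>{1..j-1}. b (j - 1) k) = real (card (prefix_edges G (j - 1)))"
      \<comment> \<open>Row 0 lies outside the assumption; there both sides vanish, as no edge has
        head 0.\<close>
      proof (cases "j = 1")
        case False
        with j have "j - 1 \<in> {1..n}" by auto
        with L show ?thesis by blast
      qed (simp add: prefix_edges_0)
      with L step[OF j] deg[OF j] j show "(\<Sum>i\<in>{Suc j..n}. x j i) + b n j - (\<Sum>k\<in>{1..<j}. x k j)
        = real (in_degree (with_proj G) j)" by simp
    qed
  next
    assume R: ?R
    \<comment> \<open>Row 0 is included so that the induction can start from the empty sum.\<close>
    have "(\<Sum>k\<in>{1..i}. b i k) = real (card (prefix_edges G i))" if "i \<le> n" for i
      using that
    proof (induction i)
      case 0
      then show ?case by (simp add: prefix_edges_0)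
    next
      case (Suc i)
      then have "Suc i \<in> {1..n}" by simp
      with R step[of "Suc i"] deg[of "Suc i"] Suc show ?case by fastforce
    qed
    then show ?L by simp
  qed
qed

lemma Sol_iff:
  "a \<in> Sol n G F \<longleftrightarrow> a \<in> {(i, j). 1 \<le> j \<and> j \<le> i \<and> i \<le> n} \<rightarrow>\<^sub>E \<int> \<and>
     (\<forall>j\<in>{1..n}. 0 \<le> a (n, j)) \<and>
     (\<forall>i j. i \<le> n \<and> j < i \<and> 1 \<le> j \<longrightarrow>
        (if (j, i) \<in> parcs G then shifted F a i j \<le> shifted F a (i - 1) j
         else shifted F a i j = shifted F a (i - 1) j)) \<and>
     (\<forall>i\<in>{1..n}. (\<Sum>k\<in>{1..i}. shifted F a i k) = real (card (prefix_edges G i)))"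
  unfolding Sol_def mem_Collect_eq Tri_def row_sums_iff shifted_def
  by (simp only: le_add_same_cancel2 conj_assoc)

section \<open>From arrays to flows\<close>

lemma Sol_drop:
  assumes "a \<in> Sol n G F" "1 \<le> j" "j < i" "i \<le> n"
  shows "if (j, i) \<in> parcs G then shifted F a i j \<le> shifted F a (i - 1) j
    else shifted F a i j = shifted F a (i - 1) j"
  using assms unfolding Sol_iff by blast

text \<open>Off the edges both sides are 0, because (ii) demands equality there.\<close>

lemma edge_value_flow_of_array:
  assumes "a \<in> Sol n G F" "1 \<le> j" "j < i" "i \<le> n"
  shows "edge_value G (flow_of_array n G F a) j i = shifted F a (i - 1) j - shifted F a i j"
  using Sol_drop[OF assms] assms(2)
  by (auto simp: edge_value_def flow_of_array_def arcs_flow_graph)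

lemma flow_of_array_Sink:
  assumes "j \<in> {1..n}"
  shows "flow_of_array n G F a (Vtx j, Sink) = a (n, j)"
  using assms by (auto simp: flow_of_array_def arcs_flow_graph)

lemma flow_of_array_in_flows:
  assumes a: "a \<in> Sol n G F"
  shows "flow_of_array n G F a \<in> integral_flows (flow_graph G) (netflow G F)"
proof -
  note S = a[unfolded Sol_iff]
  let ?f = "flow_of_array n G F a"
  have aint: "a (i, j) \<in> \<int>" if "1 \<le> j" "j \<le> i" "i \<le> n" for i j
    using S that by (auto simp: PiE_iff)
  have bint: "shifted F a i j \<in> \<int>" if "1 \<le> j" "j \<le> i" "i \<le> n" for i j
    using aint[OF that] by (simp add: shifted_def)
  have "?f e \<in> {0..} \<inter> \<int>" if e: "e \<in> arcs (flow_graph G)" for e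
  proof -
    consider (edge) j i where "e = (Vtx j, Vtx i)" "(j, i) \<in> parcs G" "1 \<le> j"
      | (sink) j where "e = (Vtx j, Sink)" "j \<in> {1..n}"
      using e by (auto simp: arcs_flow_graph)
    then show ?thesis
    proof cases
      case edge
      with parcsD have ji: "j < i" "i \<le> n" by auto
      have "?f e = shifted F a (i - 1) j - shifted F a i j"
        using edge e by (simp add: flow_of_array_def)
      moreover have "shifted F a i j \<le> shifted F a (i - 1) j"
        using Sol_drop[OF a _ ji] edge by simp
      ultimately show ?thesis using edge ji by (auto intro!: Ints_diff bint)
    next
      case sink
      then show ?thesis using S aint by (auto simp: flow_of_array_Sink)
    qed
  qed
  then have 1: "?f \<in> arcs (flow_graph G) \<rightarrow>\<^sub>E {0..} \<inter> \<int>"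
    by (auto simp: flow_of_array_def)
  have rows: "\<forall>i\<in>{1..n}. (\<Sum>k\<in>{1..i}. shifted F a i k) = real (card (prefix_edges G i))"
    using S by blast
  have "\<forall>j\<in>{1..n}. (\<Sum>i\<in>{Suc j..n}. edge_value G ?f j i) + shifted F a n j
      - (\<Sum>k\<in>{1..<j}. edge_value G ?f k j) = real (in_degree (with_proj G) j)"
    using rows row_sums_iff_conservation[of "edge_value G ?f" "shifted F a"] a
    by (simp add: edge_value_flow_of_array)
  \<comment> \<open>The summand \<open>fcount F n j\<close> of the last row of b moves to the right
    and becomes the outdegree in \<open>F\<close>.\<close>
  then have 2: "\<forall>j\<in>{1..n}. (\<Sum>i\<in>{Suc j..n}. edge_value G ?f j i) + ?f (Vtx j, Sink)
      - (\<Sum>k\<in>{1..<j}. edge_value G ?f k j)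
      = real (in_degree (with_proj G) j) - real (fcount F n j)"
    by (auto simp: flow_of_array_Sink shifted_def algebra_simps)
  \<comment> \<open>For \<open>n = 0\<close> there is no last row, but then \<open>G\<close> has no
    edges.\<close>
  have "(\<Sum>k\<in>{1..n}. shifted F a n k) = real (card (parcs G))"
    using rows by (cases "n = 0") (auto simp: prefix_edges_n[symmetric] prefix_edges_0)
  then have 3: "(\<Sum>j\<in>{1..n}. ?f (Vtx j, Sink)) = real (card (parcs G)) - real (card F)"
    by (simp add: flow_of_array_Sink shifted_def sum.distrib sum_fcount[symmetric])
  show ?thesis unfolding integral_flows_iff using 1 2 3 by blast
qed

section \<open>From flows to arrays\<close>

lemma shifted_array_of_flow:
  assumes "1 \<le> j" "j \<le> i" "i \<le> n"
  shows "shifted F (array_of_flow n G F f) i j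
    = f (Vtx j, Sink) + real (fcount F n j) + (\<Sum>k\<in>{Suc i..n}. edge_value G f j k)"
  using assms by (simp add: shifted_def array_of_flow_def)

text \<open>The tail sums for rows \<open>i - 1\<close> and \<open>i\<close> differ by the term at
  \<open>i\<close> only. This is the link between edge values and b that
  \<open>row_sums_iff_conservation\<close> asks for.\<close>

lemma shifted_array_of_flow_drop:
  assumes "1 \<le> j" "j < i" "i \<le> n"
  shows "edge_value G f j i
    = shifted F (array_of_flow n G F f) (i - 1) j - shifted F (array_of_flow n G F f) i j"
proof -
  have "{Suc (i - 1)..n} = insert i {Suc i..n}" using assms by auto
  then show ?thesis using assms by (simp add: shifted_array_of_flow)
qed

lemma array_of_flow_last:
  assumes "j \<in> {1..n}"
  shows "array_of_flow n G F f (n, j) = f (Vtx j, Sink)"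
  using assms by (simp add: array_of_flow_def)

lemma array_of_flow_in_Sol:
  assumes f: "f \<in> integral_flows (flow_graph G) (netflow G F)"
  shows "array_of_flow n G F f \<in> Sol n G F"
proof -
  note S = f[unfolded integral_flows_iff]
  let ?a = "array_of_flow n G F f"
  have e: "f e \<in> {0..} \<inter> \<int>" if "e \<in> arcs (flow_graph G)" for e
    using S that by (auto simp: PiE_iff)
  have sink: "f (Vtx j, Sink) \<in> {0..} \<inter> \<int>" if "j \<in> {1..n}" for j
    using that by (intro e) (auto simp: arcs_flow_graph)
  have ev: "edge_value G f j i \<in> {0..} \<inter> \<int>" if "1 \<le> j" for i j
    using that e[of "(Vtx j, Vtx i)"] by (auto simp: edge_value_def arcs_flow_graph)
  have "?a (i, j) \<in> \<int>" if "1 \<le> j" "j \<le> i" "i \<le> n" for i j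
    using that sink[of j] ev[of j]
    by (auto simp: array_of_flow_def intro!: Ints_add Ints_diff Ints_sum)
  then have 1: "?a \<in> {(i, j). 1 \<le> j \<and> j \<le> i \<and> i \<le> n} \<rightarrow>\<^sub>E \<int>"
    by (auto simp: PiE_iff) (auto simp: array_of_flow_def)
  have 2: "\<forall>j\<in>{1..n}. 0 \<le> ?a (n, j)"
    using sink by (auto simp: array_of_flow_last)
  \<comment> \<open>The drop is an edge value: nonnegative on an edge, 0 elsewhere.\<close>
  have 3: "if (j, i) \<in> parcs G then shifted F ?a i j \<le> shifted F ?a (i - 1) j
         else shifted F ?a i j = shifted F ?a (i - 1) j" if "1 \<le> j" "j < i" "i \<le> n" for i j
    using shifted_array_of_flow_drop[OF that, of f] ev[of j i] that
    by (auto simp: edge_value_def split: if_splits)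
  have "\<forall>j\<in>{1..n}. (\<Sum>i\<in>{Suc j..n}. edge_value G f j i) + shifted F ?a n j
      - (\<Sum>k\<in>{1..<j}. edge_value G f k j) = real (in_degree (with_proj G) j)"
  proof
    fix j assume j: "j \<in> {1..n}"
    with S have "(\<Sum>i\<in>{Suc j..n}. edge_value G f j i) + f (Vtx j, Sink)
          - (\<Sum>k\<in>{1..<j}. edge_value G f k j)
        = real (in_degree (with_proj G) j) - real (fcount F n j)" by blast
    then show "(\<Sum>i\<in>{Suc j..n}. edge_value G f j i) + shifted F ?a n j
      - (\<Sum>k\<in>{1..<j}. edge_value G f k j) = real (in_degree (with_proj G) j)"
      using j by (simp add: shifted_def array_of_flow_last)
  qed
  then have 4: "\<forall>i\<in>{1..n}. (\<Sum>k\<in>{1..i}. shifted F ?a i k) = real (card (prefix_edges G i))"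
    using row_sums_iff_conservation[of "edge_value G f" "shifted F ?a"]
      shifted_array_of_flow_drop[of _ _ f] by blast
  show ?thesis unfolding Sol_iff using 1 2 3 4 by blast
qed

section \<open>The two maps are mutually inverse\<close>

lemma array_of_flow_of_array:
  assumes a: "a \<in> Sol n G F"
  shows "array_of_flow n G F (flow_of_array n G F a) = a"
proof (rule PiE_ext)
  \<comment> \<open>The codomain \<open>UNIV\<close> leaves only extensionality to check, so
    equality reduces to the index set.\<close>
  show "array_of_flow n G F (flow_of_array n G F a) \<in> {(i, j). 1 \<le> j \<and> j \<le> i \<and> i \<le> n} \<rightarrow>\<^sub>E UNIV"
    by (auto simp: array_of_flow_def)
  show "a \<in> {(i, j). 1 \<le> j \<and> j \<le> i \<and> i \<le> n} \<rightarrow>\<^sub>E UNIV"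
    using a by (auto simp: Sol_iff PiE_iff)
  fix p assume "p \<in> {(i :: nat, j). 1 \<le> j \<and> j \<le> i \<and> i \<le> n}"
  then obtain i j where p: "p = (i, j)" and ij: "1 \<le> j" "j \<le> i" "i \<le> n" by auto
  have "(\<Sum>k\<in>{Suc i..n}. edge_value G (flow_of_array n G F a) j k)
      = (\<Sum>k\<in>{Suc i..n}. shifted F a (k - 1) j - shifted F a k j)"
    using a ij by (intro sum.cong) (auto simp: edge_value_flow_of_array)
  also have "\<dots> = shifted F a i j - shifted F a n j"
    using ij by (intro sum_drop_telescope[of i n "\<lambda>k. shifted F a k j"])
  finally show "array_of_flow n G F (flow_of_array n G F a) p = a p"
    using ij by (simp add: p array_of_flow_def flow_of_array_Sink shifted_def)
qed

lemma flow_of_array_of_flow: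
  assumes f: "f \<in> integral_flows (flow_graph G) (netflow G F)"
  shows "flow_of_array n G F (array_of_flow n G F f) = f"
proof (rule PiE_ext)
  show "flow_of_array n G F (array_of_flow n G F f) \<in> arcs (flow_graph G) \<rightarrow>\<^sub>E UNIV"
    by (auto simp: flow_of_array_def)
  show "f \<in> arcs (flow_graph G) \<rightarrow>\<^sub>E UNIV"
    using f by (auto simp: integral_flows_iff PiE_iff)
  fix e assume e: "e \<in> arcs (flow_graph G)"
  then consider (edge) j i where "e = (Vtx j, Vtx i)" "(j, i) \<in> parcs G" "1 \<le> j"
    | (sink) j where "e = (Vtx j, Sink)" "j \<in> {1..n}"
    by (auto simp: arcs_flow_graph)
  then show "flow_of_array n G F (array_of_flow n G F f) e = f e"
  proof cases
    case edge
    with parcsD have "j < i" "i \<le> n" by auto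
    with edge e shifted_array_of_flow_drop[of j i f] show ?thesis
      by (simp add: flow_of_array_def edge_value_def)
  next
    case sink
    then show ?thesis by (simp add: flow_of_array_Sink array_of_flow_last)
  qed
qed

lemma bij_betw_flow_of_array:
  "bij_betw (flow_of_array n G F) (Sol n G F) (integral_flows (flow_graph G) (netflow G F))"
  by (rule bij_betw_byWitness[where f' = "array_of_flow n G F"])
    (auto simp: array_of_flow_of_array flow_of_array_of_flow
      flow_of_array_in_flows array_of_flow_in_Sol)

lemma psi_flow_of_array:
  "psi n (flow_of_array n G F a) = map (\<lambda>j. a (n, j)) [1..<n+1]"
  by (auto simp: psi_def flow_of_array_Sink)

section \<open>Finiteness\<close>

lemma shifted_nonneg:
  assumes "a \<in> Sol n G F" "1 \<le> j" "j \<le> i" "i \<le> n"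
  shows "0 \<le> shifted F a i j"
proof -
  \<comment> \<open>The induction runs from row \<open>n\<close>, nonnegative by (i), back to row
    \<open>i\<close>; in this direction the entries of a column can only grow.\<close>
  have "\<lbrakk>1 \<le> j; j \<le> i\<rbrakk> \<Longrightarrow> 0 \<le> shifted F a i j"
    using assms(4)
  proof (induction i rule: inc_induct)
    case base
    then show ?case using assms(1) by (auto simp: Sol_iff shifted_def)
  next
    case (step m)
    then have "1 \<le> j" "j < Suc m" "Suc m \<le> n" by auto
    from Sol_drop[OF assms(1) this] have "shifted F a (Suc m) j \<le> shifted F a m j"
      by (simp split: if_splits)
    with step show ?case by simp
  qed
  with assms show ?thesis by blast
qed

lemma finite_Sol: "finite (Sol n G F)"
proof -
  let ?D = "{(i, j). 1 \<le> j \<and> j \<le> i \<and> i \<le> n}"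
  \<comment> \<open>Nonnegative entries are at most their row sum, so b lies between 0 and #E(G).
    Subtracting at most #F leaves a between -#F and #E(G).\<close>
  let ?M = "real (card (parcs G) + card F)"
  have D: "finite ?D"
    by (rule finite_subset[of _ "{0..n} \<times> {0..n}"]) auto
  have "a (i, j) \<in> {x \<in> \<int>. \<bar>x\<bar> \<le> ?M}"
    if a: "a \<in> Sol n G F" and ij: "1 \<le> j" "j \<le> i" "i \<le> n" for a i j
  proof -
    have "shifted F a i j \<le> (\<Sum>k\<in>{1..i}. shifted F a i k)"
      using a ij by (intro member_le_sum) (auto intro: shifted_nonneg)
    also have "\<dots> = real (card (prefix_edges G i))"
      using a ij by (auto simp: Sol_iff)
    also have "\<dots> \<le> real (card (parcs G))"
      using finite_parcs by (auto simp: prefix_edges_def intro!: card_mono)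
    finally have "shifted F a i j \<le> real (card (parcs G))" .
    moreover have "0 \<le> shifted F a i j" using a ij by (rule shifted_nonneg)
    moreover have "fcount F i j \<le> card F"
      unfolding fcount_def using finite_F by (auto intro: card_mono)
    moreover have "a (i, j) \<in> \<int>" using a ij by (auto simp: Sol_iff PiE_iff)
    ultimately show ?thesis by (auto simp: shifted_def)
  qed
  moreover have "a \<in> extensional ?D" if "a \<in> Sol n G F" for a
    using that by (simp add: Sol_iff PiE_iff)
  ultimately have "Sol n G F \<subseteq> ?D \<rightarrow>\<^sub>E {x \<in> \<int>. \<bar>x\<bar> \<le> ?M}"
    unfolding PiE_iff subset_iff by blast
  moreover have "finite (?D \<rightarrow>\<^sub>E {x \<in> \<int>. \<bar>x\<bar> \<le> ?M})"
    using D finite_abs_int_segment by (intro finite_PiE) auto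
  ultimately show ?thesis by (rule finite_subset)
qed

text \<open>The bijection carries the last row of an array to the values on the edges into t, so
  \<open>psi n\<close> reads off the same tuple.\<close>

lemma LD_eq_psi_image:
  "LD n G F = image_mset (psi n) (mset_set (integral_flows (flow_graph G) (netflow G F)))"
proof -
  have "mset_set (integral_flows (flow_graph G) (netflow G F))
      = image_mset (flow_of_array n G F) (mset_set (Sol n G F))"
    using bij_betw_flow_of_array by (simp add: bij_betw_def image_mset_mset_set)
  then show ?thesis
    by (simp add: LD_def image_mset.compositionality comp_def psi_flow_of_array del: upt_Suc)
qed

end

theorem corollary3p16:
  fixes n :: nat and G :: "nat pair_pre_digraph" and F :: "(nat \<times> nat) set"
  assumes "simple_graph_on n G"
    and "F \<subseteq> arcs (del_verts (with_proj G) {0})"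
  shows "finite (Sol n G F) \<and>
    finite (integral_flows (flow_graph G) (netflow G F)) \<and>
    LD n G F = image_mset (psi n) (mset_set (integral_flows (flow_graph G) (netflow G F))) \<and>
    (\<exists>\<phi>. bij_betw \<phi> (copies (LD n G F)) (integral_flows (flow_graph G) (netflow G F)) \<and>
         (\<forall>(x, k) \<in> copies (LD n G F). psi n (\<phi> (x, k)) = x))"
proof -
  \<comment> \<open>Finiteness keeps \<open>mset_set\<close> from collapsing to the empty
    multiset.\<close>
  have fin: "finite (integral_flows (flow_graph G) (netflow G F))"
    using bij_betw_finite[OF bij_betw_flow_of_array[OF assms]] finite_Sol[OF assms] by simp
  show ?thesis
    using finite_Sol[OF assms] fin copies_image_mset_bij[OF fin, of "psi n"]
    unfolding LD_eq_psi_image[OF assms] by blast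
qed

end
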